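(* Let $D=2^{<\omega}$, $\mathfrak{C}=2^\omega\cup\{\infty\}$ and the sets $K_x\subseteq \beta D\setminus D$ (for $x\in 2^\omega$) be as defined in the context. Let $\mathbb{A}$ be the subspace $$\mathbb{A}=(\mathfrak{C}\times D)\cup\bigcup_{x\in2^\omega}\bigl(\{x\}\times K_x\bigr)$$ of the product space $\mathfrak{C}\times\beta D$, and let $R=\{\infty\}\times D\subseteq\mathbb{A}$. Then $\mathbb{A}$ is realcompact, and $R$ is a closed subset of $\mathbb{A}$, homeomorphic to the discrete space $\mathbb{N}$, that is $C^*$-embedded in $\mathbb{A}$ but not $C$-embedded in $\mathbb{A}$.
   Context: A space is realcompact if it can be embedded as a closed subset into a power $\mathbb{R}^\kappa$ of the real line (with the product topology). A subset $A$ of a space $X$ is $C$-embedded in $X$ if every continuous function $f:A\to\mathbb{R}$ admits a continuous extension $\bar f:X\to\mathbb{R}$; it is $C^*$-embedded in $X$ if every bounded continuous function $f:A\to\mathbb{R}$ admits a bounded continuous extension $\bar f:X\to\mathbb{R}$. Construction. $D=2^{<\omega}$ is the (countable) set of all finite sequences of $0$s and $1$s, with the discrete topology; $2^\omega$ is the set of all infinite sequences of $0$s and $1$s. The set $cD=D\cup2^\omega$ is topologized as follows: the points of $D$ are isolated, and a point $x\in2^\omega$ has as a neighbourhood base the sets $U(x,n)=\{s\in cD: x\restriction n\subseteq s\}$, $n\in\omega$ (all finite or infinite sequences extending the initial segment $x\restriction n$ of $x$ of length $n$). This makes $cD$ a compactification of $D$. Let $\beta D$ be the Čech–Stone compactification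 of $D$, let $D^*=\beta D\setminus D$, and let $e:\beta D\to cD$ be the continuous extension of the identity map on $D$. For $x\in2^\omega$ put $K_x=\{u\in D^*: e(u)=x\}$. Let $\infty$ be a point not in $2^\omega$. The set $\mathfrak{C}=2^\omega\cup\{\infty\}$ is topologized by making every point of $2^\omega$ isolated and taking $\{U\subseteq\mathfrak{C}:\infty\in U \text{ and } |\mathfrak{C}\setminus U|\le\aleph_0\}$ as a local base at $\infty$ (so in $\mathfrak{C}$ the set $2^\omega$ does not carry its Cantor set topology). *)

theory Defs
  imports "HOL-Analysis.Analysis" "HOL-Library.Sublist"
begin

text \<open>HOL cannot quantify over the type of the index set \<open>I\<close> of the power of the real line.
  The type \<open>'a \<Rightarrow> real\<close> is large enough: coordinates of the embedding that coincide as
  functions on the space can be merged. Lemma \<open>realcompact_spaceI\<close> below confirms that a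
  closed embedding into a power with an arbitrary index type suffices.\<close>

definition realcompact_space :: "'a topology \<Rightarrow> bool" where
  "realcompact_space X \<longleftrightarrow>
     (\<exists>(I :: ('a \<Rightarrow> real) set) \<phi>.
        embedding_map X (product_topology (\<lambda>_. euclideanreal) I) \<phi> \<and>
        closedin (product_topology (\<lambda>_. euclideanreal) I) (\<phi> ` topspace X))"

definition C_embedded :: "'a topology \<Rightarrow> 'a set \<Rightarrow> bool" where
  "C_embedded X A \<longleftrightarrow> A \<subseteq> topspace X \<and>
     (\<forall>f. continuous_map (subtopology X A) euclideanreal f \<longrightarrow>
        (\<exists>g. continuous_map X euclideanreal g \<and> (\<forall>x\<in>A. g x = f x)))"

definition C_star_embedded :: "'a topology \<Rightarrow> 'a set \<Rightarrow> bool" where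
  "C_star_embedded X A \<longleftrightarrow> A \<subseteq> topspace X \<and>
     (\<forall>f. continuous_map (subtopology X A) euclideanreal f \<and> bounded (f ` A) \<longrightarrow>
        (\<exists>g. continuous_map X euclideanreal g \<and> bounded (g ` topspace X) \<and>
             (\<forall>x\<in>A. g x = f x)))"

lemma realcompact_spaceI:
  fixes X :: "'a topology" and I :: "'i set"
  assumes emb: "embedding_map X (product_topology (\<lambda>_. euclideanreal) I) \<phi>"
    and cl: "closedin (product_topology (\<lambda>_. euclideanreal) I) (\<phi> ` topspace X)"
  shows "realcompact_space X"
proof -
  let ?P = "product_topology (\<lambda>_. euclideanreal) I"
  define c where "c = (\<lambda>i x. \<phi> x i)"
  define J where "J = c ` I"
  let ?Q = "product_topology (\<lambda>_. euclideanreal) J"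
  define \<psi> where "\<psi> = (\<lambda>x. \<lambda>g\<in>J. g x)"
  define h where "h = (\<lambda>y :: ('a \<Rightarrow> real) \<Rightarrow> real. \<lambda>i\<in>I. y (c i))"
  have cont_phi: "continuous_map X ?P \<phi>"
    using emb embedding_map_def continuous_map_in_subtopology homeomorphic_imp_continuous_map
    by blast
  have ext: "\<phi> x \<in> extensional I" if "x \<in> topspace X" for x
    using continuous_map_image_subset_topspace[OF cont_phi] that
    by (auto simp: PiE_def)
  have h_psi: "h (\<psi> x) = \<phi> x" if "x \<in> topspace X" for x
    using ext[OF that]
    by (auto simp: h_def \<psi>_def c_def J_def extensional_def fun_eq_iff)
  have cont_h: "continuous_map ?Q ?P h"
    unfolding h_def
    by (rule continuous_map_componentwise[THEN iffD2])
       (auto simp: J_def intro!: continuous_map_product_projection)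
  have cont_psi: "continuous_map X ?Q \<psi>"
    unfolding \<psi>_def
  proof (rule continuous_map_componentwise[THEN iffD2], intro conjI ballI)
    fix g assume "g \<in> J"
    then obtain i where i: "i \<in> I" "g = c i" by (auto simp: J_def)
    have "continuous_map X euclideanreal (\<lambda>x. \<phi> x i)"
      using cont_phi i(1) continuous_map_componentwise[of X _ I \<phi>] by auto
    then show "continuous_map X euclideanreal (\<lambda>x. (\<lambda>g\<in>J. g x) g)"
      using \<open>g \<in> J\<close> i by (simp add: c_def)
  qed auto
  obtain k where k: "homeomorphic_maps X (subtopology ?P (\<phi> ` topspace X)) \<phi> k"
    using emb unfolding embedding_map_def homeomorphic_map_maps by blast
  have "homeomorphic_maps X (subtopology ?Q (\<psi> ` topspace X)) \<psi> (k \<circ> h)"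
    unfolding homeomorphic_maps_def
  proof (intro conjI ballI)
    show "continuous_map X (subtopology ?Q (\<psi> ` topspace X)) \<psi>"
      using cont_psi by (auto simp: continuous_map_in_subtopology)
    have "continuous_map (subtopology ?Q (\<psi> ` topspace X))
            (subtopology ?P (\<phi> ` topspace X)) h"
      using cont_h h_psi
      by (auto simp: continuous_map_in_subtopology continuous_map_from_subtopology)
    then show "continuous_map (subtopology ?Q (\<psi> ` topspace X)) X (k \<circ> h)"
      using k continuous_map_compose unfolding homeomorphic_maps_def by blast
    show "(k \<circ> h) (\<psi> x) = x" if "x \<in> topspace X" for x
      using k that h_psi by (auto simp: homeomorphic_maps_def)
    show "\<psi> ((k \<circ> h) y) = y"
      if "y \<in> topspace (subtopology ?Q (\<psi> ` topspace X))" for y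
      using k that h_psi by (auto simp: homeomorphic_maps_def)
  qed
  then have emb': "embedding_map X ?Q \<psi>"
    unfolding embedding_map_def homeomorphic_map_maps by blast
  have "\<psi> ` topspace X = {y \<in> topspace ?Q. h y \<in> \<phi> ` topspace X}"
  proof (intro equalityI subsetI)
    fix y assume "y \<in> \<psi> ` topspace X"
    then show "y \<in> {y \<in> topspace ?Q. h y \<in> \<phi> ` topspace X}"
      using continuous_map_image_subset_topspace[OF cont_psi] h_psi by blast
  next
    fix y assume y: "y \<in> {y \<in> topspace ?Q. h y \<in> \<phi> ` topspace X}"
    then obtain x where x: "x \<in> topspace X" "h y = \<phi> x" by blast
    have "y g = \<psi> x g" for g
    proof (cases "g \<in> J")
      case True
      then obtain i where i: "i \<in> I" "g = c i" by (auto simp: J_def)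
      have "y g = h y i" using i by (simp add: h_def)
      then show ?thesis using x True i by (simp add: \<psi>_def c_def)
    next
      case False
      then show ?thesis using y by (auto simp: \<psi>_def PiE_def extensional_def)
    qed
    then have "y = \<psi> x" by blast
    then show "y \<in> \<psi> ` topspace X" using x by blast
  qed
  then have "closedin ?Q (\<psi> ` topspace X)"
    using closedin_continuous_map_preimage[OF cont_h cl] by simp
  then show ?thesis
    using emb' unfolding realcompact_space_def by blast
qed

text \<open>The closure of the image of \<open>X\<close> under the evaluation map into the cube
  \<open>[0,1]\<close> to the power \<open>C(X,[0,1])\<close>. The map \<open>stone_cech_map X\<close> is the canonical
  embedding for (Tychonoff) \<open>X\<close>, under which \<open>X\<close> is regarded as a subset of its
  compactification.\<close>

definition unit_functions :: "'a topology \<Rightarrow> ('a \<Rightarrow> real) set" where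
  "unit_functions X = {f. continuous_map X (top_of_set {0..1}) f}"

definition unit_cube :: "'a topology \<Rightarrow> (('a \<Rightarrow> real) \<Rightarrow> real) topology" where
  "unit_cube X = product_topology (\<lambda>_. top_of_set {0..1}) (unit_functions X)"

definition stone_cech_map :: "'a topology \<Rightarrow> 'a \<Rightarrow> ('a \<Rightarrow> real) \<Rightarrow> real" where
  "stone_cech_map X x = (\<lambda>f\<in>unit_functions X. f x)"

definition stone_cech :: "'a topology \<Rightarrow> (('a \<Rightarrow> real) \<Rightarrow> real) topology" where
  "stone_cech X =
     subtopology (unit_cube X) (unit_cube X closure_of (stone_cech_map X ` topspace X))"

text \<open>\<open>False\<close> and \<open>True\<close> play the role of \<open>0\<close> and \<open>1\<close>.\<close>

type_synonym fin_seq = "bool list"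
type_synonym inf_seq = "nat \<Rightarrow> bool"

abbreviation treeD :: "fin_seq topology" where
  "treeD \<equiv> discrete_topology UNIV"

definition init_seg :: "inf_seq \<Rightarrow> nat \<Rightarrow> fin_seq" where
  "init_seg x n = map x [0..<n]"

definition nbhdU :: "inf_seq \<Rightarrow> nat \<Rightarrow> (fin_seq + inf_seq) set" where
  "nbhdU x n = Inl ` {s. prefix (init_seg x n) s} \<union> Inr ` {y. init_seg y n = init_seg x n}"

definition cD :: "(fin_seq + inf_seq) topology" where
  "cD = topology (\<lambda>U. \<forall>x. Inr x \<in> U \<longrightarrow> (\<exists>n. nbhdU x n \<subseteq> U))"

lemma nbhdU_mono: "m \<le> n \<Longrightarrow> nbhdU x n \<subseteq> nbhdU x m"
proof -
  assume "m \<le> n"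
  then have take_seg: "init_seg y m = take m (init_seg y n)" for y
    by (simp add: init_seg_def take_map)
  then have "prefix (init_seg x m) (init_seg x n)"
    by (simp add: take_is_prefix)
  then show ?thesis
    using take_seg by (auto simp: nbhdU_def intro: prefix_order.trans)
qed

lemma openin_cD: "openin cD U \<longleftrightarrow> (\<forall>x. Inr x \<in> U \<longrightarrow> (\<exists>n. nbhdU x n \<subseteq> U))"
proof -
  have "istopology (\<lambda>U. \<forall>x. Inr x \<in> U \<longrightarrow> (\<exists>n. nbhdU x n \<subseteq> U))"
    unfolding istopology_def
  proof (intro conjI allI impI)
    fix S T :: "(fin_seq + inf_seq) set" and x
    assume "\<forall>x. Inr x \<in> S \<longrightarrow> (\<exists>n. nbhdU x n \<subseteq> S)"
      and "\<forall>x. Inr x \<in> T \<longrightarrow> (\<exists>n. nbhdU x n \<subseteq> T)" and "Inr x \<in> S \<inter> T"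
    then obtain m n where "nbhdU x m \<subseteq> S" "nbhdU x n \<subseteq> T" by blast
    then have "nbhdU x (max m n) \<subseteq> S \<inter> T"
      using nbhdU_mono[of m "max m n" x] nbhdU_mono[of n "max m n" x] by auto
    then show "\<exists>n. nbhdU x n \<subseteq> S \<inter> T" by blast
  next
    fix \<K> :: "(fin_seq + inf_seq) set set" and x
    assume "\<forall>K\<in>\<K>. \<forall>x. Inr x \<in> K \<longrightarrow> (\<exists>n. nbhdU x n \<subseteq> K)" "Inr x \<in> \<Union>\<K>"
    then show "\<exists>n. nbhdU x n \<subseteq> \<Union>\<K>" by (meson Sup_upper UnionE subset_trans)
  qed
  then show ?thesis by (simp add: cD_def)
qed

lemma topspace_cD [simp]: "topspace cD = UNIV"
  by (metis UNIV_I openin_cD openin_subset subset_UNIV subset_antisym)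

lemma openin_nbhdU: "openin cD (nbhdU x n)"
  unfolding openin_cD
proof (intro allI impI)
  fix y assume "Inr y \<in> nbhdU x n"
  then have "nbhdU y n = nbhdU x n" by (auto simp: nbhdU_def)
  then show "\<exists>m. nbhdU y m \<subseteq> nbhdU x n" by blast
qed

abbreviation betaD :: "((fin_seq \<Rightarrow> real) \<Rightarrow> real) topology" where
  "betaD \<equiv> stone_cech treeD"

abbreviation iD :: "fin_seq \<Rightarrow> (fin_seq \<Rightarrow> real) \<Rightarrow> real" where
  "iD \<equiv> stone_cech_map treeD"

definition D_star :: "((fin_seq \<Rightarrow> real) \<Rightarrow> real) set" where
  "D_star = topspace betaD - range iD"

text \<open>The extension exists since \<open>cD\<close> is compact Hausdorff, and its values on
  \<open>topspace betaD\<close> are unique since \<open>range iD\<close> is dense; values elsewhere are irrelevant.\<close>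

definition e_map :: "((fin_seq \<Rightarrow> real) \<Rightarrow> real) \<Rightarrow> fin_seq + inf_seq" where
  "e_map = (SOME h. continuous_map betaD cD h \<and> (\<forall>s. h (iD s) = Inl s))"

definition K_fibre :: "inf_seq \<Rightarrow> ((fin_seq \<Rightarrow> real) \<Rightarrow> real) set" where
  "K_fibre x = {u \<in> D_star. e_map u = Inr x}"

text \<open>The point at infinity is \<open>None\<close>.\<close>

definition frakC :: "inf_seq option topology" where
  "frakC = topology (\<lambda>U. None \<in> U \<longrightarrow> countable (- U))"

lemma openin_frakC: "openin frakC U \<longleftrightarrow> (None \<in> U \<longrightarrow> countable (- U))"
proof -
  have "istopology (\<lambda>U :: inf_seq option set. None \<in> U \<longrightarrow> countable (- U))"
    unfolding istopology_def
  proof (intro conjI allI impI)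
    fix S T :: "inf_seq option set"
    assume "None \<in> S \<longrightarrow> countable (- S)" "None \<in> T \<longrightarrow> countable (- T)" "None \<in> S \<inter> T"
    then show "countable (- (S \<inter> T))" by (simp add: Compl_Int)
  next
    fix \<K> :: "inf_seq option set set"
    assume "\<forall>K\<in>\<K>. None \<in> K \<longrightarrow> countable (- K)" "None \<in> \<Union>\<K>"
    then obtain K where "K \<in> \<K>" "countable (- K)" by blast
    moreover from \<open>K \<in> \<K>\<close> have "- \<Union>\<K> \<subseteq> - K" by blast
    ultimately show "countable (- \<Union>\<K>)" using countable_subset by blast
  qed
  then show ?thesis by (simp add: frakC_def)
qed

lemma topspace_frakC [simp]: "topspace frakC = UNIV"
  by (metis Compl_UNIV_eq countable_empty openin_frakC openin_subset top.extremum_uniqueI)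

definition spaceA :: "(inf_seq option \<times> ((fin_seq \<Rightarrow> real) \<Rightarrow> real)) topology" where
  "spaceA = subtopology (prod_topology frakC betaD)
     (UNIV \<times> range iD \<union> (\<Union>x. {Some x} \<times> K_fibre x))"

definition setR :: "(inf_seq option \<times> ((fin_seq \<Rightarrow> real) \<Rightarrow> real)) set" where
  "setR = {None} \<times> range iD"

end

theory Submission
  imports Defs
begin

text \<open>
  The space \<open>\<bbbA>\<close> sees two kinds of convergence that cannot be combined. In the horizontal
  direction the factor \<open>\<CC>\<close> is a P-space at \<open>\<infinity>\<close>, so a continuous real function on
  \<open>\<CC> \<times> {s}\<close> equals its value at \<open>\<infinity>\<close> for all but countably many \<open>x\<close>
  (\<open>countable_neq_on_row\<close>). As \<open>D\<close> is countable, a continuous \<open>g\<close> on \<open>\<bbbA>\<close> therefore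
  agrees with its restriction to \<open>R\<close> on the whole column \<open>{x} \<times> D\<close>, for some \<open>x\<close>. In the
  vertical direction, the branch of initial segments of \<open>x\<close> accumulates at a point of the
  compact fibre \<open>K\<^sub>x\<close> (\<open>branch_accumulates\<close>), so \<open>g\<close> cannot tend to infinity along it. Hence
  the length function on \<open>R\<close> has no continuous extension. A bounded function on \<open>R\<close>, on the
  other hand, extends over \<open>\<beta>D\<close> and thus over \<open>\<CC> \<times> \<beta>D\<close>, constantly in the first variable.

  For realcompactness, evaluation at all continuous functions embeds the Tychonoff space
  \<open>\<bbbA>\<close> in a power of the line. A point \<open>y\<close> in the closure of the image is a choice of
  values \<open>y f\<close>, any countably many of which are attained simultaneously at a point of \<open>\<bbbA>\<close>;
  it remains to find one point that attains all of them (\<open>realcompact_if_countably_attained\<close>).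
  Countably many functions decide which element of \<open>D\<close> is the second coordinate, if any.
  If it is some \<open>s\<close>, then either the first coordinate is decided too, or it avoids every
  countable subset of \<open>2\<^sup>\<omega>\<close> and the point is \<open>(\<infinity>, s)\<close>. Otherwise the second coordinate
  lies in a fibre \<open>K\<^sub>x\<close>; the binary digits of \<open>x\<close> are again countably many continuous
  functions of the point, so \<open>x\<close> is decided, and compactness of \<open>K\<^sub>x\<close> gives the point.
\<close>

section \<open>A criterion for realcompactness\<close>

definition real_functions :: "'a topology \<Rightarrow> ('a \<Rightarrow> real) set" where
  "real_functions X = {f. continuous_map X euclideanreal f}"

definition eval_map :: "'a topology \<Rightarrow> 'a \<Rightarrow> ('a \<Rightarrow> real) \<Rightarrow> real" where
  "eval_map X x = (\<lambda>f\<in>real_functions X. f x)"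

lemma continuous_map_indicator_clopen:
  assumes "openin X U" "closedin X U"
  shows "continuous_map X euclideanreal (\<lambda>x. if x \<in> U then 1 else 0)"
proof -
  have "openin X {x \<in> topspace X. x \<in> U}" "openin X {x \<in> topspace X. x \<notin> U}"
    using assms openin_subset[OF assms(1)]
    by (auto simp: closedin_def Collect_conj_eq Int_absorb1 Diff_eq Compl_eq)
  moreover have "{x \<in> topspace X. (if x \<in> U then 1 else 0 :: real) \<in> V} =
      (if 1 \<in> V then {x \<in> topspace X. x \<in> U} else {}) \<union>
      (if 0 \<in> V then {x \<in> topspace X. x \<notin> U} else {})" for V
    by auto
  ultimately show ?thesis
    by (auto simp: continuous_map_def)
qed

lemma embedding_map_eval_map:
  assumes cr: "completely_regular_space X" and T2: "Hausdorff_space X"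
  shows "embedding_map X (product_topology (\<lambda>_. euclideanreal) (real_functions X)) (eval_map X)"
proof -
  let ?P = "product_topology (\<lambda>_. euclideanreal) (real_functions X)"
  let ?E = "eval_map X ` topspace X"
  have cont: "continuous_map X ?P (eval_map X)"
    unfolding eval_map_def
    by (rule continuous_map_componentwise[THEN iffD2]) (auto simp: real_functions_def)
  have inj: "inj_on (eval_map X) (topspace X)"
  proof (rule inj_onI, rule ccontr)
    fix x y assume xy: "x \<in> topspace X" "y \<in> topspace X" "eval_map X x = eval_map X y" "x \<noteq> y"
    have "closedin X {y}"
      using T2 xy(2) by (simp add: closedin_Hausdorff_singleton)
    then obtain f where f: "continuous_map X euclideanreal f" "f x = 0" "f ` {y} \<subseteq> {1}"
      using cr xy unfolding completely_regular_space_alt by (metis Diff_iff singletonD)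
    then have "eval_map X x f = 0" "eval_map X y f = 1"
      by (auto simp: eval_map_def real_functions_def)
    then show False using xy(3) by simp
  qed
  have opn: "open_map X (subtopology ?P ?E) (eval_map X)"
    unfolding open_map_def
  proof (intro allI impI)
    fix U assume U: "openin X U"
    show "openin (subtopology ?P ?E) (eval_map X ` U)"
    proof (subst openin_subopen, clarify)
      fix x assume x: "x \<in> U"
      then obtain f where f: "continuous_map X euclideanreal f" "f x = 0"
          "f ` (topspace X - U) \<subseteq> {1}"
        using cr U unfolding completely_regular_space_alt' by meson
      have fC: "f \<in> real_functions X" using f(1) by (simp add: real_functions_def)
      have "openin ?P {z \<in> topspace ?P. z f \<in> {..<1}}"
        by (intro openin_continuous_map_preimage[where Y=euclideanreal]
            continuous_map_product_projection fC) simp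
      then have "openin (subtopology ?P ?E) ({z \<in> topspace ?P. z f \<in> {..<1}} \<inter> ?E)"
        by (rule openin_subtopology_Int)
      moreover have "eval_map X x \<in> {z \<in> topspace ?P. z f \<in> {..<1}} \<inter> ?E"
        using x U openin_subset fC f(2) by (fastforce simp: eval_map_def)
      moreover have "{z \<in> topspace ?P. z f \<in> {..<1}} \<inter> ?E \<subseteq> eval_map X ` U"
      proof clarify
        fix z assume "z \<in> topspace X" "eval_map X z f < 1"
        then have "z \<in> U" using f(3) fC by (force simp: eval_map_def)
        then show "eval_map X z \<in> eval_map X ` U" by blast
      qed
      ultimately show "\<exists>T. openin (subtopology ?P ?E) T \<and> eval_map X x \<in> T \<and> T \<subseteq> eval_map X ` U"
        by blast
    qed
  qed
  show ?thesis
    unfolding embedding_map_def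
  proof (rule bijective_open_imp_homeomorphic_map[OF _ opn _ inj])
    show "continuous_map X (subtopology ?P ?E) (eval_map X)"
      using cont by (auto simp: continuous_map_in_subtopology)
    show "eval_map X ` topspace X = topspace (subtopology ?P ?E)"
      using continuous_map_image_subset_topspace[OF cont] by auto
  qed
qed

lemma closure_of_eval_map_approx:
  assumes y: "y \<in> product_topology (\<lambda>_. euclideanreal) (real_functions X) closure_of
                   (eval_map X ` topspace X)"
    and F: "finite F" "F \<subseteq> real_functions X" and d: "d > 0"
  shows "\<exists>x\<in>topspace X. \<forall>f\<in>F. \<bar>f x - y f\<bar> < d"
proof -
  let ?P = "product_topology (\<lambda>_. euclideanreal) (real_functions X)"
  let ?T = "PiE (real_functions X) (\<lambda>f. if f \<in> F then ball (y f) d else UNIV)"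
  have "openin ?P ?T"
  proof (rule product_topology_basis)
    show "finite {i. (if i \<in> F then ball (y i) d else UNIV) \<noteq> topspace euclideanreal}"
      by (rule finite_subset[OF _ F(1)]) auto
  qed auto
  moreover have "y \<in> ?T"
    using y d by (auto simp: in_closure_of PiE_iff)
  ultimately obtain x where x: "x \<in> topspace X" "eval_map X x \<in> ?T"
    using y unfolding in_closure_of by blast
  have "\<bar>f x - y f\<bar> < d" if "f \<in> F" for f
  proof -
    have "eval_map X x f \<in> ball (y f) d"
      using x(2) that F(2) by (auto simp: PiE_iff split: if_splits)
    then show ?thesis
      using that F(2) by (auto simp: eval_map_def dist_real_def)
  qed
  then show ?thesis using x by blast
qed

text \<open>If the values were never attained simultaneously, then the sum of the truncated
  distances \<open>min 1 \<bar>f\<^sub>i - y f\<^sub>i\<bar> / 2\<^sup>i\<close> would be a positive continuous function. Its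
  reciprocal is continuous, and so it is almost equal to a finite value at points at which
  the sum is arbitrarily small.\<close>

lemma closure_of_eval_map_sequence:
  fixes f :: "nat \<Rightarrow> 'a \<Rightarrow> real"
  assumes y: "y \<in> product_topology (\<lambda>_. euclideanreal) (real_functions X) closure_of
                   (eval_map X ` topspace X)"
    and f: "\<And>i. f i \<in> real_functions X"
  shows "\<exists>x\<in>topspace X. \<forall>i. f i x = y (f i)"
proof (rule ccontr)
  assume "\<not> ?thesis"
  then have none: "\<forall>x\<in>topspace X. \<exists>i. f i x \<noteq> y (f i)" by simp
  define t where "t = (\<lambda>i x. min 1 \<bar>f i x - y (f i)\<bar> * (1/2::real) ^ i)"
  define g where "g = (\<lambda>x. \<Sum>i. t i x)"
  have t0: "0 \<le> t i x" for i x by (simp add: t_def)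
  have t1: "t i x \<le> (1/2) ^ i" for i x
    by (simp add: t_def mult_left_le_one_le)
  have geo: "summable (\<lambda>i. (1/2::real) ^ i)" by (simp add: summable_geometric)
  have smm: "summable (\<lambda>i. t i x)" for x
    by (rule summable_comparison_test'[OF geo, of 0]) (use t0 t1 in auto)
  have tail: "0 \<le> g x - (\<Sum>i<N. t i x)" "g x - (\<Sum>i<N. t i x) \<le> 2 * (1/2) ^ N" for x N
  proof -
    have eq: "g x - (\<Sum>i<N. t i x) = (\<Sum>i. t (i + N) x)"
      unfolding g_def using suminf_split_initial_segment[OF smm, of x N] by simp
    have s1: "summable (\<lambda>i. t (i + N) x)"
      by (rule summable_ignore_initial_segment[OF smm])
    show "0 \<le> g x - (\<Sum>i<N. t i x)"
      unfolding eq using s1 t0 by (simp add: suminf_nonneg)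
    have "t (i + N) x \<le> (1/2) ^ N * (1/2) ^ i" for i
      using t1[of "i + N" x] by (simp add: power_add mult.commute)
    then have "(\<Sum>i. t (i + N) x) \<le> (\<Sum>i. (1/2) ^ N * (1/2) ^ i)"
      by (intro suminf_le s1 summable_mult geo)
    also have "\<dots> = (1/2) ^ N * 2"
      using suminf_mult[OF geo, of "(1/2) ^ N"] by (simp add: suminf_geometric)
    finally show "g x - (\<Sum>i<N. t i x) \<le> 2 * (1/2) ^ N"
      unfolding eq by linarith
  qed
  have pos: "g x > 0" if x: "x \<in> topspace X" for x
  proof -
    obtain i where i: "f i x \<noteq> y (f i)" using none x by blast
    have "0 < t i x" using i by (simp add: t_def)
    also have "t i x \<le> g x"
      unfolding g_def using sum_le_suminf[OF smm, of "{i}" x] t0 by simp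
    finally show ?thesis .
  qed
  have contt: "continuous_map X euclideanreal (t i)" for i
    unfolding t_def using f[of i] unfolding real_functions_def
    by (intro continuous_intros) auto
  have "continuous_map X Met_TC.mtopology g"
  proof (rule Met_TC.continuous_map_uniform_limit_alt[where F=sequentially
        and f="\<lambda>N x. \<Sum>i<N. t i x"])
    show "\<forall>\<^sub>F N in sequentially. continuous_map X Met_TC.mtopology (\<lambda>x. \<Sum>i<N. t i x)"
      using contt by (auto intro!: always_eventually continuous_map_sum)
    show "g \<in> topspace X \<rightarrow> UNIV" by simp
    fix e :: real assume "0 < e"
    have "(\<lambda>N. 2 * (1/2::real) ^ N) \<longlonglongrightarrow> 2 * 0"
      by (intro tendsto_mult tendsto_const LIMSEQ_power_zero) simp
    from order_tendstoD(2)[OF this, of e]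
    have "\<forall>\<^sub>F N in sequentially. 2 * (1/2::real) ^ N < e"
      using \<open>0 < e\<close> by simp
    then show "\<forall>\<^sub>F N in sequentially. \<forall>x\<in>topspace X. dist (\<Sum>i<N. t i x) (g x) < e"
    proof eventually_elim
      case (elim N)
      have "\<bar>(\<Sum>i<N. t i x) - g x\<bar> < e" for x
        using tail[of x N] elim by linarith
      then show ?case by (simp add: dist_real_def)
    qed
  qed simp
  then have contg: "continuous_map X euclideanreal g"
    by simp
  define k where "k = (\<lambda>x. inverse (g x))"
  have k: "k \<in> real_functions X"
    unfolding k_def real_functions_def using contg pos
    by (force intro!: continuous_map_real_inverse)
  obtain N where N: "4 * (y k + 1) < 2 ^ N" using real_arch_pow[of 2] by force
  let ?F = "insert k (f ` {..<N})"
  obtain x where x: "x \<in> topspace X" "\<And>h. h \<in> ?F \<Longrightarrow> \<bar>h x - y h\<bar> < min 1 ((1/2) ^ N)"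
    using closure_of_eval_map_approx[OF y, of ?F "min 1 ((1/2) ^ N)"] f k by fastforce
  have "(\<Sum>i<N. t i x) \<le> (\<Sum>i<N. (1/2) ^ N * (1/2) ^ i)"
  proof (rule sum_mono)
    fix i assume "i \<in> {..<N}"
    then have "\<bar>f i x - y (f i)\<bar> \<le> (1/2) ^ N" using x(2)[of "f i"] by simp
    then show "t i x \<le> (1/2) ^ N * (1/2) ^ i"
      unfolding t_def by (intro mult_right_mono) auto
  qed
  also have "\<dots> \<le> (1/2) ^ N * (\<Sum>i. (1/2) ^ i)"
    unfolding sum_distrib_left[symmetric]
    by (intro mult_left_mono sum_le_suminf geo) auto
  also have "\<dots> = 2 * (1/2) ^ N" by (simp add: suminf_geometric)
  finally have "g x \<le> 4 * (1/2) ^ N" using tail(2)[of x N] by linarith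
  then have "inverse (4 * (1/2) ^ N) \<le> k x"
    unfolding k_def using pos[OF x(1)] by (rule le_imp_inverse_le)
  then have "2 ^ N \<le> 4 * k x" by (simp add: power_one_over field_simps)
  also have "4 * k x < 4 * (y k + 1)" using x(2)[of k] by auto
  also note N
  finally show False .
qed

text \<open>A family \<open>y\<close> of values that is countably attained corresponds to a zero-set ultrafilter
  with the countable intersection property. The condition says that each of these is fixed.\<close>

lemma realcompact_if_countably_attained:
  assumes "completely_regular_space X" "Hausdorff_space X"
    and attained: "\<And>y. (\<And>F. countable F \<Longrightarrow> F \<subseteq> real_functions X \<Longrightarrow>
                          \<exists>x\<in>topspace X. \<forall>f\<in>F. f x = y f) \<Longrightarrow>
                     \<exists>x\<in>topspace X. \<forall>f\<in>real_functions X. f x = y f"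
  shows "realcompact_space X"
proof -
  let ?P = "product_topology (\<lambda>_. euclideanreal) (real_functions X)"
  let ?E = "eval_map X ` topspace X"
  have "?P closure_of ?E \<subseteq> ?E"
  proof
    fix y assume y: "y \<in> ?P closure_of ?E"
    have "\<exists>x\<in>topspace X. \<forall>f\<in>F. f x = y f" if F: "countable F" "F \<subseteq> real_functions X" for F
    proof (cases "F = {}")
      case True
      have "?E \<noteq> {}" using y by (metis closure_of_empty empty_iff)
      then show ?thesis using True by blast
    next
      case False
      then have "range (from_nat_into F) = F" using F by (simp add: range_from_nat_into)
      then show ?thesis
        using closure_of_eval_map_sequence[OF y, of "from_nat_into F"] F(2)
        by (metis rangeE rangeI subsetD)
    qed
    then obtain x where x: "x \<in> topspace X" "\<And>f. f \<in> real_functions X \<Longrightarrow> f x = y f"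
      using attained[of y] by blast
    have "y \<in> extensional (real_functions X)"
      using y by (auto simp: in_closure_of PiE_iff)
    then have "y = eval_map X x"
      using x(2) by (auto simp: eval_map_def fun_eq_iff extensional_def)
    then show "y \<in> ?E" using x(1) by blast
  qed
  moreover have emb: "embedding_map X ?P (eval_map X)"
    using assms by (intro embedding_map_eval_map)
  moreover have "?E \<subseteq> topspace ?P"
    by (auto simp: eval_map_def)
  ultimately have "closedin ?P ?E"
    using closure_of_subset_eq by blast
  then show ?thesis
    unfolding realcompact_space_def using emb by blast
qed

section \<open>The Stone--Cech compactification of the tree\<close>

lemma closedin_betaD_carrier:
  "closedin (unit_cube treeD) (unit_cube treeD closure_of range iD)"
  by simp

lemma betaD_eq: "betaD = subtopology (unit_cube treeD) (unit_cube treeD closure_of range iD)"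
  by (simp add: stone_cech_def)

lemma compact_space_betaD: "compact_space betaD"
proof -
  have "compact_space (unit_cube treeD)"
    unfolding unit_cube_def
    by (simp add: compact_space_product_topology compact_space_subtopology)
  then show ?thesis
    unfolding betaD_eq
    by (intro compact_space_subtopology closedin_compact_space closedin_betaD_carrier)
qed

lemma Hausdorff_space_betaD: "Hausdorff_space betaD"
  unfolding betaD_eq unit_cube_def
  by (intro Hausdorff_space_subtopology)
     (simp add: Hausdorff_space_product_topology Hausdorff_space_subtopology)

lemma completely_regular_space_betaD: "completely_regular_space betaD"
  by (simp add: compact_Hausdorff_or_regular_imp_normal_space compact_space_betaD
      Hausdorff_space_betaD normal_imp_completely_regular_space)

lemma iD_in_unit_cube: "iD s \<in> topspace (unit_cube treeD)"
  by (auto simp: unit_cube_def stone_cech_map_def unit_functions_def)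

lemma iD_in_betaD [simp]: "iD s \<in> topspace betaD"
proof -
  have "range iD \<subseteq> unit_cube treeD closure_of range iD"
    by (intro closure_of_subset) (use iD_in_unit_cube in auto)
  then show ?thesis
    unfolding betaD_eq using iD_in_unit_cube by auto
qed

lemma betaD_dense:
  assumes "u \<in> topspace betaD" "openin betaD U" "u \<in> U"
  shows "\<exists>s. iD s \<in> U"
proof -
  obtain T where T: "openin (unit_cube treeD) T" "U = T \<inter> unit_cube treeD closure_of range iD"
    using assms(2) unfolding betaD_eq openin_subtopology by blast
  then have "u \<in> T" "u \<in> unit_cube treeD closure_of range iD"
    using assms(3) by auto
  then obtain s where "iD s \<in> T"
    using T(1) unfolding in_closure_of by blast
  moreover have "iD s \<in> unit_cube treeD closure_of range iD"
    using iD_in_betaD[of s] unfolding betaD_eq by simp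
  ultimately show ?thesis using T by blast
qed

lemma unit_functions_treeD: "f \<in> unit_functions treeD \<longleftrightarrow> range f \<subseteq> {0..1}"
  by (auto simp: unit_functions_def)

lemma iD_apply: "f \<in> unit_functions treeD \<Longrightarrow> iD s f = f s"
  by (simp add: stone_cech_map_def)

lemma betaD_coordinate_range:
  assumes "u \<in> topspace betaD" "f \<in> unit_functions treeD"
  shows "u f \<in> {0..1}"
  using assms by (auto simp: betaD_eq unit_cube_def PiE_iff)

text \<open>The coordinate at \<open>f\<close> is the extension of \<open>f\<close> to the compactification.\<close>

lemma continuous_map_betaD_coordinate:
  assumes "f \<in> unit_functions treeD"
  shows "continuous_map betaD euclideanreal (\<lambda>u. u f)"
proof -
  have "continuous_map (unit_cube treeD) (top_of_set {0..1}) (\<lambda>u. u f)"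
    unfolding unit_cube_def by (rule continuous_map_product_projection[OF assms])
  then have "continuous_map (unit_cube treeD) euclideanreal (\<lambda>u. u f)"
    by (simp add: continuous_map_in_subtopology)
  then show ?thesis
    unfolding betaD_eq by (rule continuous_map_from_subtopology)
qed

text \<open>The clopen set of all ultrafilters on \<open>D\<close> that contain \<open>S\<close>. The coordinate of a point at
  an indicator function is \<open>0\<close> or \<open>1\<close>, by density, so that any threshold between them works.\<close>

definition hat :: "fin_seq set \<Rightarrow> ((fin_seq \<Rightarrow> real) \<Rightarrow> real) set" where
  "hat S = {u \<in> topspace betaD. u (\<lambda>s. if s \<in> S then 1 else 0) \<in> {1/2<..}}"

lemma indicator_unit_function: "(\<lambda>s. if s \<in> S then 1 else 0) \<in> unit_functions treeD"
  by (auto simp: unit_functions_treeD)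

lemma iD_in_hat [simp]: "iD s \<in> hat S \<longleftrightarrow> s \<in> S"
  by (simp add: hat_def iD_apply[OF indicator_unit_function])

lemma openin_hat: "openin betaD (hat S)"
  unfolding hat_def
  by (rule openin_continuous_map_preimage[OF continuous_map_betaD_coordinate
        [OF indicator_unit_function]]) simp

lemma closedin_hat: "closedin betaD (hat S)"
proof -
  let ?\<chi> = "\<lambda>s. if s \<in> S then 1 else 0 :: real"
  note cont = continuous_map_betaD_coordinate[OF indicator_unit_function[of S]]
  have "openin betaD {u \<in> topspace betaD. u ?\<chi> \<in> {1/4<..<3/4}}"
    by (rule openin_continuous_map_preimage[OF cont]) simp
  then have "u ?\<chi> \<notin> {1/4<..<3/4}" if u: "u \<in> topspace betaD" for u
    using betaD_dense[OF u, of "{u \<in> topspace betaD. u ?\<chi> \<in> {1/4<..<3/4}}"] u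
    by (auto simp: iD_apply[OF indicator_unit_function] split: if_splits)
  then have "hat S = {u \<in> topspace betaD. u ?\<chi> \<in> {1/2..}}"
    unfolding hat_def by force
  also have "closedin betaD \<dots>"
    by (rule closedin_continuous_map_preimage[OF cont]) simp
  finally show ?thesis .
qed

lemma hat_singleton: "hat {s} = {iD s}"
proof (intro equalityI subsetI)
  fix u assume u: "u \<in> hat {s}"
  show "u \<in> {iD s}"
  proof (rule ccontr)
    assume "u \<notin> {iD s}"
    then have "u \<in> hat {s} - {iD s}" using u by simp
    moreover have "openin betaD (hat {s} - {iD s})"
      by (intro openin_diff openin_hat closedin_Hausdorff_singleton[OF Hausdorff_space_betaD]) simp
    moreover have "u \<in> topspace betaD" using u by (simp add: hat_def)
    ultimately obtain t where "iD t \<in> hat {s} - {iD s}" using betaD_dense by blast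
    then show False by auto
  qed
qed simp

lemma inj_iD: "inj iD"
  by (rule injI) (metis hat_singleton iD_in_hat singletonD singletonI)

lemma openin_iD_singleton: "openin betaD {iD s}"
  using openin_hat[of "{s}"] by (simp add: hat_singleton)

lemma closedin_iD_singleton: "closedin betaD {iD s}"
  using closedin_hat[of "{s}"] by (simp add: hat_singleton)

section \<open>The map onto the compactification by branches\<close>

text \<open>A point outside \<open>D\<close> goes to the branch whose \<open>n\<close>-th digit is decided by the ultrafilter:
  exactly one of the values \<open>0\<close> and \<open>1\<close> is the \<open>n\<close>-th digit of almost every sequence. This
  gives the extension that the definition of \<open>e_map\<close> selects.\<close>

definition bit_set :: "nat \<Rightarrow> fin_seq set" where
  "bit_set n = {s. n < length s \<and> s ! n}"

definition branch_of :: "((fin_seq \<Rightarrow> real) \<Rightarrow> real) \<Rightarrow> inf_seq" where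
  "branch_of u = (\<lambda>n. u \<in> hat (bit_set n))"

definition e_explicit :: "((fin_seq \<Rightarrow> real) \<Rightarrow> real) \<Rightarrow> fin_seq + inf_seq" where
  "e_explicit u = (if u \<in> range iD then Inl (inv iD u) else Inr (branch_of u))"

lemma prefix_init_seg_iff:
  "prefix (init_seg x n) s \<longleftrightarrow> n \<le> length s \<and> (\<forall>i<n. s ! i = x i)"
proof
  assume "prefix (init_seg x n) s"
  then obtain t where "s = init_seg x n @ t" by (auto simp: prefix_def)
  then show "n \<le> length s \<and> (\<forall>i<n. s ! i = x i)"
    by (auto simp: init_seg_def nth_append)
next
  assume s: "n \<le> length s \<and> (\<forall>i<n. s ! i = x i)"
  then have "init_seg x n = take n s"
    by (auto simp: init_seg_def list_eq_iff_nth_eq)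
  then show "prefix (init_seg x n) s" by (simp add: take_is_prefix)
qed

lemma length_init_seg: "length (init_seg x n) = n"
  by (simp add: init_seg_def)

lemma init_seg_nth: "i < n \<Longrightarrow> init_seg x n ! i = x i"
  by (simp add: init_seg_def)

lemma init_seg_eq_iff: "init_seg x n = init_seg y n \<longleftrightarrow> (\<forall>i<n. x i = y i)"
  by (auto simp: init_seg_def)

text \<open>Near a point outside \<open>D\<close>, the first \<open>n\<close> digits are constant, and the finitely many
  sequences of length less than \<open>n\<close> do not occur.\<close>

lemma continuous_map_e_explicit: "continuous_map betaD cD e_explicit"
  unfolding continuous_map_def
proof (intro conjI allI impI)
  show "e_explicit \<in> topspace betaD \<rightarrow> topspace cD" by simp
  fix U assume U: "openin cD U"
  show "openin betaD {u \<in> topspace betaD. e_explicit u \<in> U}" (is "openin betaD ?V")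
  proof (subst openin_subopen, intro ballI)
    fix u assume u: "u \<in> ?V"
    show "\<exists>T. openin betaD T \<and> u \<in> T \<and> T \<subseteq> ?V"
    proof (cases "u \<in> range iD")
      case True
      then obtain s where "u = iD s" by blast
      then show ?thesis using u openin_iD_singleton[of s] by blast
    next
      case False
      then have "Inr (branch_of u) \<in> U" using u by (simp add: e_explicit_def)
      then obtain n where n: "nbhdU (branch_of u) n \<subseteq> U" using U by (auto simp: openin_cD)
      let ?H = "\<lambda>i. if branch_of u i then hat (bit_set i) else topspace betaD - hat (bit_set i)"
      let ?L = "{s :: fin_seq. length s < n}"
      let ?T = "(\<Inter>i\<in>{..<n}. ?H i) \<inter> topspace betaD - iD ` ?L"
      have "finite {s :: fin_seq. set s \<subseteq> UNIV \<and> length s \<le> n}"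
        by (rule finite_lists_length_le) simp
      then have "finite ?L"
        by (rule rev_finite_subset) auto
      then have "closedin betaD (iD ` ?L)"
        by (intro closedin_Hausdorff_finite[OF Hausdorff_space_betaD]) auto
      moreover have "openin betaD (?H i)" for i
        by (simp add: openin_hat closedin_hat openin_diff)
      then have "openin betaD ((\<Inter>i\<in>{..<n}. ?H i) \<inter> topspace betaD)"
        by (intro openin_INT) auto
      ultimately have "openin betaD ?T" by (intro openin_diff)
      moreover have "u \<in> ?T" using u False by (auto simp: branch_of_def)
      moreover have "?T \<subseteq> ?V"
      proof
        fix v assume v: "v \<in> ?T"
        have digit: "v \<in> hat (bit_set i) \<longleftrightarrow> branch_of u i" if "i < n" for i
        proof -
          have "v \<in> ?H i" using v that by blast
          then show ?thesis by (auto split: if_splits)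
        qed
        have "e_explicit v \<in> nbhdU (branch_of u) n"
        proof (cases "v \<in> range iD")
          case True
          then obtain s where s: "v = iD s" by blast
          have len: "n \<le> length s" using v s by force
          then have "s ! i = branch_of u i" if "i < n" for i
            using digit[OF that] that by (simp add: s bit_set_def)
          then show ?thesis
            using len by (auto simp: s e_explicit_def inj_iD nbhdU_def prefix_init_seg_iff)
        next
          case False
          then show ?thesis
            using digit by (auto simp: e_explicit_def nbhdU_def init_seg_eq_iff branch_of_def)
        qed
        then show "v \<in> ?V" using v n by blast
      qed
      ultimately show ?thesis by blast
    qed
  qed
qed

lemma e_map_properties: "continuous_map betaD cD e_map \<and> (\<forall>s. e_map (iD s) = Inl s)"
  unfolding e_map_def
proof (rule someI[where x=e_explicit])
  show "continuous_map betaD cD e_explicit \<and> (\<forall>s. e_explicit (iD s) = Inl s)"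
    by (simp add: continuous_map_e_explicit e_explicit_def inj_iD)
qed

lemma continuous_map_e_map: "continuous_map betaD cD e_map"
  and e_map_iD [simp]: "e_map (iD s) = Inl s"
  using e_map_properties by auto

text \<open>The points of \<open>cD\<close> whose \<open>n\<close>-th digit exists and is \<open>1\<close>. These countably many clopen
  sets separate the branches.\<close>

definition digit_set :: "nat \<Rightarrow> (fin_seq + inf_seq) set" where
  "digit_set n = Inl ` bit_set n \<union> Inr ` {x. x n}"

lemma clopen_digit_set: "openin cD (digit_set n)" "closedin cD (digit_set n)"
proof -
  have *: "z \<in> digit_set n \<longleftrightarrow> x n" if z: "z \<in> nbhdU x (Suc n)" for x z
  proof (cases z)
    case (Inl s)
    then have "prefix (init_seg x (Suc n)) s" using z by (auto simp: nbhdU_def)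
    then show ?thesis using Inl
      by (auto simp: prefix_init_seg_iff digit_set_def bit_set_def)
  next
    case (Inr y)
    then have "init_seg y (Suc n) = init_seg x (Suc n)" using z by (auto simp: nbhdU_def)
    then show ?thesis using Inr
      by (auto simp: init_seg_eq_iff digit_set_def)
  qed
  have digit: "Inr x \<in> digit_set n \<longleftrightarrow> x n" for x by (auto simp: digit_set_def)
  show "openin cD (digit_set n)"
    unfolding openin_cD using * digit by (metis subsetI)
  have "openin cD (- digit_set n)"
    unfolding openin_cD using * digit by (metis ComplD ComplI subsetI)
  then show "closedin cD (digit_set n)"
    by (simp add: closedin_def Compl_eq_Diff_UNIV)
qed

lemma closedin_cD_branch: "closedin cD {Inr x}"
proof -
  have "\<exists>n. nbhdU y n \<subseteq> - {Inr x}" if neq: "y \<noteq> x" for y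
  proof -
    obtain n where "y n \<noteq> x n" using neq by blast
    then have "Inr x \<notin> nbhdU y (Suc n)"
      by (auto simp: nbhdU_def init_seg_eq_iff)
    then show ?thesis by blast
  qed
  then have "openin cD (- {Inr x})"
    unfolding openin_cD by blast
  then show ?thesis by (simp add: closedin_def Compl_eq_Diff_UNIV)
qed

lemma K_fibre_eq: "K_fibre x = {u \<in> topspace betaD. e_map u \<in> {Inr x}}"
  by (auto simp: K_fibre_def D_star_def)

lemma closedin_K_fibre: "closedin betaD (K_fibre x)"
  unfolding K_fibre_eq
  by (rule closedin_continuous_map_preimage[OF continuous_map_e_map closedin_cD_branch])

lemma closedin_nbhdU: "closedin cD (nbhdU x n)"
proof -
  have "nbhdU y n \<subseteq> - nbhdU x n" if "Inr y \<notin> nbhdU x n" for y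
    using that by (auto simp: nbhdU_def prefix_init_seg_iff init_seg_eq_iff)
  then have "openin cD (- nbhdU x n)"
    unfolding openin_cD by blast
  then show ?thesis by (simp add: closedin_def Compl_eq_Diff_UNIV)
qed

text \<open>The closures of the final segments of the branch have a common point, by compactness. Its
  image lies in the closed set \<open>U(x,m)\<close> for every \<open>m\<close>, and \<open>x\<close> is the only such point.\<close>

lemma branch_accumulates:
  "\<exists>u\<in>K_fibre x. \<forall>V m. openin betaD V \<and> u \<in> V \<longrightarrow> (\<exists>n\<ge>m. iD (init_seg x n) \<in> V)"
proof -
  define B where "B = (\<lambda>m. (\<lambda>n. iD (init_seg x n)) ` {m..})"
  have "(\<Inter>m. betaD closure_of B m) \<noteq> {}"
  proof (rule compact_space_imp_nest[OF compact_space_betaD])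
    have "B m \<subseteq> topspace betaD" "B m \<noteq> {}" for m by (auto simp: B_def)
    then show "betaD closure_of B m \<noteq> {}" for m by (simp add: closure_of_eq_empty)
    show "decseq (\<lambda>m. betaD closure_of B m)"
      by (intro decseq_SucI closure_of_mono) (auto simp: B_def)
  qed simp
  then obtain u where u: "\<And>m. u \<in> betaD closure_of B m" by blast
  have "e_map u \<in> nbhdU x m" for m
  proof -
    have "e_map u \<in> cD closure_of (e_map ` B m)"
      using continuous_map_image_closure_subset[OF continuous_map_e_map] u by blast
    also have "cD closure_of (e_map ` B m) \<subseteq> nbhdU x m"
      by (intro closure_of_minimal closedin_nbhdU)
         (auto simp: B_def nbhdU_def prefix_init_seg_iff length_init_seg init_seg_nth)
    finally show ?thesis .
  qed
  note near = this
  have "e_map u = Inr x"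
  proof (cases "e_map u")
    case (Inl s)
    then show ?thesis using near[of "Suc (length s)"] by (auto simp: nbhdU_def prefix_init_seg_iff)
  next
    case (Inr y)
    then have "y n = x n" for n using near[of "Suc n"] by (auto simp: nbhdU_def init_seg_eq_iff)
    then show ?thesis using Inr by auto
  qed
  then have "u \<in> K_fibre x"
    using u[of 0] by (auto simp: K_fibre_eq in_closure_of)
  moreover have "\<exists>n\<ge>m. iD (init_seg x n) \<in> V" if V: "openin betaD V" "u \<in> V" for V m
    using u[of m] V unfolding in_closure_of B_def by fastforce
  ultimately show ?thesis by blast
qed

section \<open>The space and its rows\<close>

lemma uncountable_inf_seq: "uncountable (UNIV :: inf_seq set)"
proof
  assume "countable (UNIV :: inf_seq set)"
  then have enum: "range (from_nat_into (UNIV :: inf_seq set)) = UNIV"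
    by (simp add: range_from_nat_into)
  have "(\<lambda>n. \<not> from_nat_into (UNIV :: inf_seq set) n n) \<in> range (from_nat_into UNIV)"
    unfolding enum by simp
  then obtain k where "(\<lambda>n. \<not> from_nat_into (UNIV :: inf_seq set) n n) = from_nat_into UNIV k"
    by blast
  from fun_cong[OF this, of k] show False by simp
qed

lemma frakC_clopen_if_Some:
  assumes "None \<notin> U" "countable U"
  shows "openin frakC U" "closedin frakC U"
  using assms by (auto simp: openin_frakC closedin_def Compl_eq_Diff_UNIV[symmetric])

lemma Hausdorff_space_frakC: "Hausdorff_space frakC"
  unfolding Hausdorff_space_def
proof (intro allI impI, elim conjE)
  fix x y :: "inf_seq option" assume neq: "x \<noteq> y"
  have *: "\<exists>U V. openin frakC U \<and> openin frakC V \<and> x \<in> U \<and> y \<in> V \<and> disjnt U V"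
    if "x \<noteq> None" "x \<noteq> y" for x y
    using that by (intro exI[of _ "{x}"] exI[of _ "- {x}"]) (auto simp: openin_frakC)
  show "\<exists>U V. openin frakC U \<and> openin frakC V \<and> x \<in> U \<and> y \<in> V \<and> disjnt U V"
    using *[of x y] *[of y x] neq by (metis disjnt_sym)
qed

lemma completely_regular_space_frakC: "completely_regular_space frakC"
  unfolding completely_regular_space_alt'
proof (intro allI impI)
  fix S x assume S: "openin frakC S" "x \<in> S"
  \<comment> \<open>An open set that contains \<open>\<infinity>\<close> is itself clopen.\<close>
  define U where "U = (if x = None then S else {x})"
  have U: "openin frakC (- U)" "closedin frakC (- U)" "x \<in> U" "U \<subseteq> S"
    using S by (auto simp: U_def openin_frakC closedin_def Compl_eq_Diff_UNIV[symmetric])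
  then show "\<exists>f. continuous_map frakC euclideanreal f \<and> f x = 0 \<and> f ` (topspace frakC - S) \<subseteq> {1}"
    using continuous_map_indicator_clopen[of frakC "- U"]
    by (intro exI[of _ "\<lambda>z. if z \<in> - U then 1 else 0"]) auto
qed

text \<open>The set on which \<open>h\<close> differs from its value at \<open>\<infinity>\<close> is the union over \<open>n\<close> of the
  complements of the neighbourhoods of \<open>\<infinity>\<close> on which it differs by less than \<open>1/(n+1)\<close>.\<close>

lemma countable_neq_at_infinity:
  assumes h: "continuous_map frakC euclideanreal h"
  shows "countable {c. h c \<noteq> h None}"
proof -
  have "countable (- {c. h c \<in> ball (h None) (1 / real (Suc n))})" for n
  proof -
    have "openin frakC {c \<in> topspace frakC. h c \<in> ball (h None) (1 / real (Suc n))}"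
      by (rule openin_continuous_map_preimage[OF h]) simp
    then show ?thesis by (simp add: openin_frakC)
  qed
  then have "countable (\<Union>n. - {c. h c \<in> ball (h None) (1 / real (Suc n))})" by simp
  moreover have "{c. h c \<noteq> h None} \<subseteq> (\<Union>n. - {c. h c \<in> ball (h None) (1 / real (Suc n))})"
  proof
    fix c assume "c \<in> {c. h c \<noteq> h None}"
    then obtain n where "inverse (real (Suc n)) < dist (h None) (h c)"
      using reals_Archimedean[of "dist (h None) (h c)"] by auto
    then show "c \<in> (\<Union>n. - {c. h c \<in> ball (h None) (1 / real (Suc n))})"
      by (auto simp: inverse_eq_divide intro!: exI[of _ n])
  qed
  ultimately show ?thesis by (rule countable_subset[rotated])
qed

lemma topspace_spaceA:
  "topspace spaceA = UNIV \<times> range iD \<union> (\<Union>x. {Some x} \<times> K_fibre x)"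
  by (auto simp: spaceA_def K_fibre_eq)

lemma row_in_spaceA [simp]: "(c, iD s) \<in> topspace spaceA"
  by (simp add: topspace_spaceA)

lemma fibre_in_spaceA: "u \<in> K_fibre x \<Longrightarrow> (Some x, u) \<in> topspace spaceA"
  by (simp add: topspace_spaceA)

lemma spaceA_cases:
  assumes "p \<in> topspace spaceA"
  obtains (row) c s where "p = (c, iD s)" | (fibre) x u where "p = (Some x, u)" "u \<in> K_fibre x"
  using assms by (auto simp: topspace_spaceA)

lemma continuous_map_spaceA_fst: "continuous_map spaceA frakC fst"
  and continuous_map_spaceA_snd: "continuous_map spaceA betaD snd"
  by (simp_all add: spaceA_def continuous_map_from_subtopology continuous_map_fst continuous_map_snd)

lemma continuous_map_into_spaceA:
  assumes "continuous_map X frakC f" "continuous_map X betaD g"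
    and "\<And>z. z \<in> topspace X \<Longrightarrow> (f z, g z) \<in> topspace spaceA"
  shows "continuous_map X spaceA (\<lambda>z. (f z, g z))"
proof -
  have "continuous_map X (prod_topology frakC betaD) (\<lambda>z. (f z, g z))"
    using assms by (simp add: continuous_map_pairwise o_def)
  then show ?thesis
    using assms(3) unfolding topspace_spaceA unfolding spaceA_def
    by (intro continuous_map_into_subtopology) auto
qed

lemma continuous_map_row: "continuous_map frakC spaceA (\<lambda>c. (c, iD s))"
  by (rule continuous_map_into_spaceA) auto

lemma countable_neq_on_row:
  assumes "continuous_map spaceA euclideanreal g"
  shows "countable {c. g (c, iD s) \<noteq> g (None, iD s)}"
  using countable_neq_at_infinity[OF continuous_map_compose[OF continuous_map_row assms]]
  by (simp add: o_def)

lemma Hausdorff_space_spaceA: "Hausdorff_space spaceA"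
  unfolding spaceA_def
  by (intro Hausdorff_space_subtopology)
     (simp add: Hausdorff_space_prod_topology Hausdorff_space_frakC Hausdorff_space_betaD)

lemma completely_regular_space_spaceA: "completely_regular_space spaceA"
  unfolding spaceA_def
  by (intro completely_regular_space_subtopology)
     (simp add: completely_regular_space_prod_topology completely_regular_space_frakC
        completely_regular_space_betaD)

section \<open>Realcompactness\<close>

text \<open>The continuous functions that locate a point of \<open>\<bbbA>\<close>. The row tests and the digit tests
  are countably many and may be used all at once; the column tests are not.\<close>

definition column_test :: "inf_seq \<Rightarrow> inf_seq option \<times> ((fin_seq \<Rightarrow> real) \<Rightarrow> real) \<Rightarrow> real" where
  "column_test x p = (if fst p \<in> {Some x} then 1 else 0)"

definition row_test :: "fin_seq \<Rightarrow> inf_seq option \<times> ((fin_seq \<Rightarrow> real) \<Rightarrow> real) \<Rightarrow> real" where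
  "row_test s p = (if snd p \<in> {iD s} then 1 else 0)"

definition digit_test :: "nat \<Rightarrow> inf_seq option \<times> ((fin_seq \<Rightarrow> real) \<Rightarrow> real) \<Rightarrow> real" where
  "digit_test n p = (if e_map (snd p) \<in> digit_set n then 1 else 0)"

lemma tests_continuous:
  "column_test x \<in> real_functions spaceA"
  "row_test s \<in> real_functions spaceA"
  "digit_test n \<in> real_functions spaceA"
proof -
  have "continuous_map frakC euclideanreal (\<lambda>c. if c \<in> {Some x} then 1 else 0)"
    by (intro continuous_map_indicator_clopen frakC_clopen_if_Some) auto
  from continuous_map_compose[OF continuous_map_spaceA_fst this]
  show "column_test x \<in> real_functions spaceA"
    by (simp add: real_functions_def column_test_def[abs_def] o_def)
  have "continuous_map betaD euclideanreal (\<lambda>u. if u \<in> {iD s} then 1 else 0)"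
    by (intro continuous_map_indicator_clopen openin_iD_singleton closedin_iD_singleton)
  from continuous_map_compose[OF continuous_map_spaceA_snd this]
  show "row_test s \<in> real_functions spaceA"
    by (simp add: real_functions_def row_test_def[abs_def] o_def)
  have "continuous_map cD euclideanreal (\<lambda>z. if z \<in> digit_set n then 1 else 0)"
    by (intro continuous_map_indicator_clopen clopen_digit_set)
  from continuous_map_compose[OF continuous_map_compose[OF continuous_map_spaceA_snd
        continuous_map_e_map] this]
  show "digit_test n \<in> real_functions spaceA"
    by (simp add: real_functions_def digit_test_def[abs_def] o_def)
qed

lemma digit_test_fibre:
  assumes "u \<in> K_fibre x"
  shows "digit_test n (c, u) = (if x n then 1 else 0)"
  using assms by (auto simp: digit_test_def digit_set_def K_fibre_eq)

text \<open>If \<open>y\<close> places the point in row \<open>s\<close> but in no column \<open>x \<in> 2\<^sup>\<omega>\<close>, then each \<open>f\<close> may be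
  tested together with the countably many columns in which it differs from its value at
  \<open>(\<infinity>, s)\<close>. If \<open>y\<close> places the point in no row, then the digit tests single out \<open>x\<close>, and
  the sets \<open>{u \<in> K\<^sub>x. f (x, u) = y f}\<close> have the finite intersection property.\<close>

lemma realcompact_space_spaceA: "realcompact_space spaceA"
proof (rule realcompact_if_countably_attained)
  show "completely_regular_space spaceA" by (rule completely_regular_space_spaceA)
  show "Hausdorff_space spaceA" by (rule Hausdorff_space_spaceA)
  fix y assume y: "\<And>F. countable F \<Longrightarrow> F \<subseteq> real_functions spaceA \<Longrightarrow>
                     \<exists>p\<in>topspace spaceA. \<forall>f\<in>F. f p = y f"
  show "\<exists>p\<in>topspace spaceA. \<forall>f\<in>real_functions spaceA. f p = y f"
  proof (cases "\<exists>s. y (row_test s) \<noteq> 0")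
    case True
    then obtain s where s: "y (row_test s) \<noteq> 0" by blast
    have row: "snd p = iD s" if "row_test s p = y (row_test s)" for p
      using s that by (auto simp: row_test_def split: if_splits)
    show ?thesis
    proof (cases "\<exists>x. y (column_test x) \<noteq> 0")
      case True
      then obtain x where x: "y (column_test x) \<noteq> 0" by blast
      have "f (Some x, iD s) = y f" if f: "f \<in> real_functions spaceA" for f
      proof -
        obtain q where q: "row_test s q = y (row_test s)"
            "column_test x q = y (column_test x)" "f q = y f"
          using y[of "{row_test s, column_test x, f}"] f tests_continuous by auto
        have "fst q = Some x" using x q(2) by (auto simp: column_test_def split: if_splits)
        then have "q = (Some x, iD s)" using row[OF q(1)] by (simp add: prod_eq_iff)
        then show ?thesis using q(3) by simp
      qed
      then show ?thesis by (intro bexI[of _ "(Some x, iD s)"]) auto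
    next
      case False
      have "f (None, iD s) = y f" if f: "f \<in> real_functions spaceA" for f
      proof -
        define N where "N = {x. f (Some x, iD s) \<noteq> f (None, iD s)}"
        have "countable {c. f (c, iD s) \<noteq> f (None, iD s)}"
          using f by (intro countable_neq_on_row) (simp add: real_functions_def)
        then have "countable (the ` {c. f (c, iD s) \<noteq> f (None, iD s)})" by simp
        then have "countable N"
          by (rule countable_subset[rotated]) (force simp: N_def)
        then obtain q where q: "row_test s q = y (row_test s)" "f q = y f"
            "\<And>x. x \<in> N \<Longrightarrow> column_test x q = y (column_test x)"
          using y[of "insert f (insert (row_test s) (column_test ` N))"] f tests_continuous
          by (auto simp: image_subset_iff)
        obtain c where c: "q = (c, iD s)" using row[OF q(1)] by (cases q) auto
        have "c \<noteq> Some x" if "x \<in> N" for x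
          using q(3)[OF that] False by (auto simp: column_test_def c)
        then have "f (c, iD s) = f (None, iD s)"
          by (cases c) (auto simp: N_def)
        then show ?thesis using q(2) c by simp
      qed
      then show ?thesis by (intro bexI[of _ "(None, iD s)"]) auto
    qed
  next
    case False
    define F0 where "F0 = range row_test \<union> range digit_test"
    have F0: "countable F0" "F0 \<subseteq> real_functions spaceA"
      using tests_continuous by (auto simp: F0_def)
    have in_fibre: "\<exists>x u. p = (Some x, u) \<and> u \<in> K_fibre x \<and>
                      (\<forall>n. y (digit_test n) = (if x n then 1 else 0))"
      if p: "p \<in> topspace spaceA" "\<And>f. f \<in> F0 \<Longrightarrow> f p = y f" for p
      using p(1)
    proof (cases rule: spaceA_cases)
      case (row c s)
      then have "y (row_test s) = 1" using p(2)[of "row_test s"] by (simp add: F0_def row_test_def)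
      then show ?thesis using False by auto
    next
      case (fibre x u)
      have "y (digit_test n) = (if x n then 1 else 0)" for n
        using p(2)[of "digit_test n"] digit_test_fibre[OF fibre(2), of n "Some x"] fibre(1)
        by (simp add: F0_def)
      then show ?thesis using fibre by blast
    qed
    obtain p where p: "p \<in> topspace spaceA" "\<And>f. f \<in> F0 \<Longrightarrow> f p = y f"
      using y[OF F0] by blast
    obtain x where x: "\<And>n. y (digit_test n) = (if x n then 1 else 0)"
      using in_fibre[OF p] by blast
    have attained: "\<exists>u\<in>K_fibre x. \<forall>f\<in>F. f (Some x, u) = y f"
      if F: "countable F" "F \<subseteq> real_functions spaceA" for F
    proof -
      obtain q where q: "q \<in> topspace spaceA" "\<And>f. f \<in> F \<union> F0 \<Longrightarrow> f q = y f"
        using y[of "F \<union> F0"] F F0 by auto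
      then obtain x' u where u: "q = (Some x', u)" "u \<in> K_fibre x'"
          "\<And>n. y (digit_test n) = (if x' n then 1 else 0)"
        using in_fibre[of q] by auto
      have "x' n = x n" for n
        using u(3)[of n] x[of n] by (auto split: if_splits)
      then have "x' = x" by auto
      then show ?thesis using u q(2) by blast
    qed
    let ?Z = "\<lambda>f. {u \<in> K_fibre x. f (Some x, u) \<in> {y f}}"
    have closed: "closedin betaD (?Z f)" if f: "f \<in> real_functions spaceA" for f
    proof -
      let ?K = "subtopology betaD (K_fibre x)"
      have topK: "topspace ?K = K_fibre x" by (auto simp: K_fibre_eq)
      have "continuous_map ?K spaceA (\<lambda>u. (Some x, u))"
      proof (rule continuous_map_into_spaceA)
        show "continuous_map ?K betaD (\<lambda>u. u)"
          by (simp add: continuous_map_from_subtopology)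
      qed (use topK fibre_in_spaceA in auto)
      then have "continuous_map ?K euclideanreal (f \<circ> (\<lambda>u. (Some x, u)))"
        using f by (intro continuous_map_compose) (auto simp: real_functions_def)
      then have "closedin ?K {u \<in> topspace ?K. (f \<circ> (\<lambda>u. (Some x, u))) u \<in> {y f}}"
        by (rule closedin_continuous_map_preimage) simp
      then have "closedin ?K (?Z f)" by (simp add: topK del: topspace_subtopology)
      then show ?thesis
        using closedin_K_fibre closedin_closed_subtopology by blast
    qed
    have fip: "K_fibre x \<inter> \<Inter>\<F> \<noteq> {}" if F: "finite \<F>" "\<F> \<subseteq> ?Z ` real_functions spaceA" for \<F>
    proof -
      obtain F where F': "finite F" "F \<subseteq> real_functions spaceA" "\<F> = ?Z ` F"
        using finite_subset_image[OF F] by blast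
      then obtain u where "u \<in> K_fibre x" "\<And>f. f \<in> F \<Longrightarrow> f (Some x, u) = y f"
        using attained[of F] countable_finite by blast
      then show ?thesis using F'(3) by blast
    qed
    have compact: "compactin betaD (K_fibre x)"
      by (rule closedin_compact_space[OF compact_space_betaD closedin_K_fibre])
    have "K_fibre x \<inter> \<Inter>(?Z ` real_functions spaceA) \<noteq> {}"
    proof (rule compactin_fip[THEN iffD1, OF compact, THEN conjunct2, THEN spec, THEN mp],
        intro conjI allI impI ballI)
      fix C assume "C \<in> ?Z ` real_functions spaceA"
      then show "closedin betaD C" using closed by (elim imageE) (simp only:)
    next
      fix \<F> assume "finite \<F> \<and> \<F> \<subseteq> ?Z ` real_functions spaceA"
      then show "K_fibre x \<inter> \<Inter>\<F> \<noteq> {}" using fip by (elim conjE)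
    qed
    then obtain u where "u \<in> K_fibre x \<inter> \<Inter>(?Z ` real_functions spaceA)"
      unfolding ex_in_conv[symmetric] by (rule exE)
    then have "u \<in> K_fibre x" "\<forall>f\<in>real_functions spaceA. f (Some x, u) = y f"
      by auto
    then show ?thesis using fibre_in_spaceA by blast
  qed
qed

section \<open>The row at infinity\<close>

lemma setR_subset: "setR \<subseteq> topspace spaceA"
  by (auto simp: setR_def)

lemma closedin_setR: "closedin spaceA setR"
proof -
  have "closedin frakC {None}"
    by (simp add: closedin_Hausdorff_singleton Hausdorff_space_frakC)
  then have "closedin spaceA {p \<in> topspace spaceA. fst p \<in> {None}}"
    by (rule closedin_continuous_map_preimage[OF continuous_map_spaceA_fst])
  moreover have "{p \<in> topspace spaceA. fst p \<in> {None}} = setR"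
    by (auto simp: topspace_spaceA setR_def)
  ultimately show ?thesis by simp
qed

lemma subtopology_setR: "subtopology spaceA setR = discrete_topology setR"
proof -
  have "openin (subtopology spaceA setR) {(None, iD s)}" for s
  proof -
    have "openin spaceA {p \<in> topspace spaceA. snd p \<in> {iD s}}"
      by (rule openin_continuous_map_preimage[OF continuous_map_spaceA_snd openin_iD_singleton])
    then have "openin (subtopology spaceA setR) ({p \<in> topspace spaceA. snd p \<in> {iD s}} \<inter> setR)"
      by (rule openin_subtopology_Int)
    moreover have "{p \<in> topspace spaceA. snd p \<in> {iD s}} \<inter> setR = {(None, iD s)}"
      by (auto simp: setR_def)
    ultimately show ?thesis by simp
  qed
  moreover have "topspace (subtopology spaceA setR) = setR"
    using setR_subset by auto
  ultimately show ?thesis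
    by (subst eq_commute, subst discrete_topology_unique) (auto simp: setR_def)
qed

lemma setR_homeomorphic_nat:
  "subtopology spaceA setR homeomorphic_space discrete_topology (UNIV :: nat set)"
proof -
  have "inj (\<lambda>s. (None :: inf_seq option, iD s))"
    using inj_iD by (auto simp: inj_def)
  then have "bij_betw (\<lambda>s. (None :: inf_seq option, iD s)) UNIV setR"
    by (auto simp: bij_betw_def setR_def)
  moreover obtain k :: "fin_seq \<Rightarrow> nat" where "bij k"
    using countableE_infinite[of "UNIV :: fin_seq set"] infinite_UNIV_listI by auto
  ultimately have "bij_betw (k \<circ> inv_into UNIV (\<lambda>s. (None :: inf_seq option, iD s))) setR UNIV"
    by (blast intro: bij_betw_trans bij_betw_inv_into)
  then have "homeomorphic_map (discrete_topology setR) (discrete_topology (UNIV :: nat set))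
      (k \<circ> inv_into UNIV (\<lambda>s. (None :: inf_seq option, iD s)))"
    by (intro bijective_open_imp_homeomorphic_map) (auto simp: bij_betw_def open_map_def)
  then show ?thesis
    unfolding subtopology_setR homeomorphic_space by blast
qed

lemma C_star_embedded_setR: "C_star_embedded spaceA setR"
  unfolding C_star_embedded_def
proof (intro conjI setR_subset allI impI, elim conjE)
  fix f :: "inf_seq option \<times> ((fin_seq \<Rightarrow> real) \<Rightarrow> real) \<Rightarrow> real"
  assume "bounded (f ` setR)"
  then obtain B where B: "B > 0" "\<And>p. p \<in> setR \<Longrightarrow> \<bar>f p\<bar> \<le> B"
    unfolding bounded_pos by auto
  \<comment> \<open>Rescaled to the unit interval, \<open>f\<close> is one of the coordinates of the compactification.\<close>
  define \<phi> where "\<phi> = (\<lambda>s. (f (None, iD s) + B) / (2 * B))"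
  have \<phi>: "\<phi> \<in> unit_functions treeD"
    unfolding unit_functions_treeD
  proof clarify
    fix s
    have "\<bar>f (None, iD s)\<bar> \<le> B" using B(2) by (simp add: setR_def)
    then show "\<phi> s \<in> {0..1}" using B(1) by (auto simp: \<phi>_def field_simps)
  qed
  define g where "g = (\<lambda>p :: inf_seq option \<times> ((fin_seq \<Rightarrow> real) \<Rightarrow> real). 2 * B * snd p \<phi> - B)"
  have "continuous_map spaceA euclideanreal ((\<lambda>u. u \<phi>) \<circ> snd)"
    by (rule continuous_map_compose[OF continuous_map_spaceA_snd
          continuous_map_betaD_coordinate[OF \<phi>]])
  then have "continuous_map spaceA euclideanreal g"
    unfolding g_def o_def by (intro continuous_intros) auto
  moreover have "bounded (g ` topspace spaceA)"
  proof (rule boundedI)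
    fix r assume "r \<in> g ` topspace spaceA"
    then obtain p where p: "p \<in> topspace spaceA" "r = g p" by blast
    then have "snd p \<in> topspace betaD"
      using continuous_map_image_subset_topspace[OF continuous_map_spaceA_snd] by blast
    then have "snd p \<phi> \<in> {0..1}" by (rule betaD_coordinate_range[OF _ \<phi>])
    then have "0 \<le> B * snd p \<phi>" "B * snd p \<phi> \<le> B"
      using B(1) by (auto simp: mult_left_le)
    then show "norm r \<le> B" by (simp add: p(2) g_def abs_le_iff)
  qed
  moreover have "g p = f p" if p: "p \<in> setR" for p
  proof -
    obtain s where s: "p = (None, iD s)" using p by (auto simp: setR_def)
    have "g p = 2 * B * \<phi> s - B" by (simp add: g_def s iD_apply[OF \<phi>])
    then show ?thesis using B(1) by (simp add: \<phi>_def s)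
  qed
  ultimately show "\<exists>g. continuous_map spaceA euclideanreal g \<and> bounded (g ` topspace spaceA) \<and>
      (\<forall>p\<in>setR. g p = f p)"
    by blast
qed

text \<open>The function without extension is the length of a sequence, which is unbounded along every
  branch.\<close>

lemma not_C_embedded_setR: "\<not> C_embedded spaceA setR"
proof
  assume C: "C_embedded spaceA setR"
  define f where "f = (\<lambda>p :: inf_seq option \<times> ((fin_seq \<Rightarrow> real) \<Rightarrow> real).
      real (length (inv iD (snd p))))"
  have "continuous_map (subtopology spaceA setR) euclideanreal f"
    by (simp add: subtopology_setR)
  then obtain g where g: "continuous_map spaceA euclideanreal g" "\<And>p. p \<in> setR \<Longrightarrow> g p = f p"
    using C unfolding C_embedded_def by blast
  have g_infinity: "g (None, iD s) = real (length s)" for s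
    using g(2) by (simp add: setR_def f_def inj_iD)
  \<comment> \<open>Each of the countably many rows excludes only countably many columns.\<close>
  define N where "N = the ` (\<Union>s. {c. g (c, iD s) \<noteq> g (None, iD s)})"
  have "countable (\<Union>s. {c. g (c, iD s) \<noteq> g (None, iD s)})"
    using countable_neq_on_row[OF g(1)] by simp
  then have "countable N"
    unfolding N_def by (rule countable_image)
  then have "N \<noteq> UNIV"
    using uncountable_inf_seq by blast
  then obtain x where x: "x \<notin> N"
    by blast
  have gx: "g (Some x, iD s) = real (length s)" for s
  proof (rule ccontr)
    assume "g (Some x, iD s) \<noteq> real (length s)"
    then have "Some x \<in> (\<Union>s. {c. g (c, iD s) \<noteq> g (None, iD s)})"
      unfolding g_infinity by blast
    from imageI[OF this, of the] show False using x by (simp add: N_def)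
  qed
  obtain u where u: "u \<in> K_fibre x"
      "\<And>V m. openin betaD V \<Longrightarrow> u \<in> V \<Longrightarrow> \<exists>n\<ge>m. iD (init_seg x n) \<in> V"
    using branch_accumulates[of x] by blast
  let ?S = "range iD \<union> K_fibre x"
  have S: "?S \<subseteq> topspace betaD" by (auto simp: K_fibre_eq)
  have "continuous_map (subtopology betaD ?S) spaceA (\<lambda>u. (Some x, u))"
    by (rule continuous_map_into_spaceA) (auto simp: topspace_spaceA)
  then have "continuous_map (subtopology betaD ?S) euclideanreal (g \<circ> (\<lambda>u. (Some x, u)))"
    using g(1) by (rule continuous_map_compose)
  then have "openin (subtopology betaD ?S) {v \<in> topspace (subtopology betaD ?S).
      (g \<circ> (\<lambda>u. (Some x, u))) v \<in> {..<g (Some x, u) + 1}}"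
    by (rule openin_continuous_map_preimage) simp
  then obtain V where V: "openin betaD V" "{v \<in> topspace (subtopology betaD ?S).
      (g \<circ> (\<lambda>u. (Some x, u))) v \<in> {..<g (Some x, u) + 1}} = V \<inter> ?S"
    unfolding openin_subtopology by blast
  have "u \<in> V" using V(2) u(1) S by auto
  moreover obtain m where m: "g (Some x, u) + 1 \<le> real m" using real_arch_simple by blast
  ultimately obtain n where n: "n \<ge> m" "iD (init_seg x n) \<in> V" using u(2)[OF V(1)] by blast
  then have "iD (init_seg x n) \<in> V \<inter> ?S" by simp
  then have "g (Some x, iD (init_seg x n)) < g (Some x, u) + 1"
    unfolding V(2)[symmetric] by simp
  then show False using n(1) m by (simp add: gx length_init_seg)
qed

theorem mainTheorem2:
  shows "realcompact_space spaceA \<and>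
         closedin spaceA setR \<and>
         subtopology spaceA setR homeomorphic_space discrete_topology (UNIV :: nat set) \<and>
         C_star_embedded spaceA setR \<and>
         \<not> C_embedded spaceA setR"
  using realcompact_space_spaceA closedin_setR setR_homeomorphic_nat C_star_embedded_setR
    not_C_embedded_setR by blast

end
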